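(* Let $k\ge1$, $n=3^k$, and $f=\mathrm{Maj}_3^{\circ k}\colon\mathbb F_2^n\to\{+1,-1\}$. Then for every $0\le d\le n$ and every linear subspace $A\le\mathbb F_2^n$ of dimension $d$, $$\sum_{S\in A}\hat f(S)^2\le\frac{4d}{n}.$$
   Context: Boolean values are written as $\pm1$ (bit $0\mapsto+1$, bit $1\mapsto-1$); $\mathrm{Maj}_3\colon\mathbb F_2^3\to\{+1,-1\}$ is the majority of three bits, with Fourier expansion $\mathrm{Maj}_3=\frac12(\chi_{\{1\}}+\chi_{\{2\}}+\chi_{\{3\}}-\chi_{\{1,2,3\}})$ where $\chi_S(x)=(-1)^{\sum_{i\in S}x_i}$. Composition: for $f\colon\mathbb F_2^a\to\{\pm1\}$ and $g\colon\mathbb F_2^m\to\{\pm1\}$, $(f\circ g)(x)=f(g(x_1,\dots,x_m),g(x_{m+1},\dots,x_{2m}),\dots,g(x_{m(a-1)+1},\dots,x_{ma}))$ (values of $g$ converted back to bits). $\mathrm{Maj}_3^{\circ1}=\mathrm{Maj}_3$ and $\mathrm{Maj}_3^{\circ k}=\mathrm{Maj}_3\circ\mathrm{Maj}_3^{\circ(k-1)}$. Fourier coefficients: $\hat f(S)=\mathbb E_{x\sim U(\mathbb F_2^n)}[f(x)(-1)^{S\cdot x}]$. *)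

theory Defs
  imports Complex_Main "HOL-Library.Z2" "HOL-Library.Function_Algebras"
begin

text \<open>
  Vectors over the two-element field are functions from \<^typ>\<open>nat\<close> to \<^typ>\<open>bit\<close>; the space of
  dimension \<open>n\<close> consists of those vanishing outside the coordinates \<open>0, ..., n - 1\<close>
  (coordinates are counted from 0).
\<close>

definition F2vec :: "nat \<Rightarrow> (nat \<Rightarrow> bit) set" where
  "F2vec n = {x. \<forall>i\<ge>n. x i = 0}"

definition F2scale :: "bit \<Rightarrow> (nat \<Rightarrow> bit) \<Rightarrow> (nat \<Rightarrow> bit)" where
  "F2scale c x = (\<lambda>i. c * x i)"

global_interpretation F2: vector_space F2scale
  by unfold_locales
    (simp_all only: F2scale_def fun_eq_iff plus_fun_apply distrib_left distrib_right mult.assoc mult_1_left simp_thms)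

definition bit_sign :: "bit \<Rightarrow> real" where
  "bit_sign b = (if b = 0 then 1 else - 1)"

definition sign_bit :: "real \<Rightarrow> bit" where
  "sign_bit r = (if r = 1 then 0 else 1)"

definition Maj3 :: "(nat \<Rightarrow> bit) \<Rightarrow> real" where
  "Maj3 x = bit_sign (if 2 \<le> card {i. i < 3 \<and> x i = 1} then 1 else 0)"

text \<open>
  \<open>bool_comp a m f g\<close> is the composition of \<open>f\<close> of arity \<open>a\<close> with \<open>g\<close> of arity \<open>m\<close>; the \<open>j\<close>-th
  block of the input, moved to the coordinates \<open>0, ..., m - 1\<close>, is \<open>block m j x\<close>.
\<close>

definition block :: "nat \<Rightarrow> nat \<Rightarrow> (nat \<Rightarrow> bit) \<Rightarrow> (nat \<Rightarrow> bit)" where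
  "block m j x = (\<lambda>i. if i < m then x (j * m + i) else 0)"

definition bool_comp ::
  "nat \<Rightarrow> nat \<Rightarrow> ((nat \<Rightarrow> bit) \<Rightarrow> real) \<Rightarrow> ((nat \<Rightarrow> bit) \<Rightarrow> real) \<Rightarrow> (nat \<Rightarrow> bit) \<Rightarrow> real" where
  "bool_comp a m f g x = f (\<lambda>j. if j < a then sign_bit (g (block m j x)) else 0)"

text \<open>The value at exponent 0 is a convention only: the iterate is meant for positive exponents.\<close>

fun Maj3_iter :: "nat \<Rightarrow> (nat \<Rightarrow> bit) \<Rightarrow> real" where
  "Maj3_iter 0 = (\<lambda>x. bit_sign (x 0))"
| "Maj3_iter (Suc 0) = Maj3"
| "Maj3_iter (Suc (Suc k)) = bool_comp 3 (3 ^ Suc k) Maj3 (Maj3_iter (Suc k))"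

definition fourier_coeff :: "nat \<Rightarrow> ((nat \<Rightarrow> bit) \<Rightarrow> real) \<Rightarrow> (nat \<Rightarrow> bit) \<Rightarrow> real" where
  "fourier_coeff n f S =
     (\<Sum>x\<in>F2vec n. f x * bit_sign (\<Sum>i<n. S i * x i)) / real (card (F2vec n))"

end

theory Submission
  imports Defs "HOL-Library.FuncSet" "HOL-Library.Cardinality"
begin

text \<open>
  The squared Fourier coefficients of a function of \<open>n\<close> bits with values \<open>\<plusminus>1\<close> form a probability
  distribution. Call it \<open>K\<close>-spread if every subspace \<open>A\<close> has mass at most \<open>K * dim A\<close>. The claim
  holds even without the factor 4, that is with \<open>K = 1 / n\<close>.

  Let \<open>\<mu>\<close> be the distribution of \<open>g\<close>, with \<open>\<mu> 0 = 0\<close>. The expansion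
  \<open>Maj\<^sub>3 = (\<chi>\<^sub>1 + \<chi>\<^sub>2 + \<chi>\<^sub>3 - \<chi>\<^sub>1 * \<chi>\<^sub>2 * \<chi>\<^sub>3) / 2\<close> shows that the distribution of
  \<open>Maj\<^sub>3 \<circ> g\<close> is the uniform mixture of the three copies of \<open>\<mu>\<close> on a single block and of the product \<open>\<mu> \<times> \<mu> \<times> \<mu>\<close>. For \<open>a\<close>
  blocks, such a mixture is \<open>K / a\<close>-spread whenever \<open>\<mu>\<close> is \<open>K\<close>-spread: Let \<open>A\<^sub>i\<close> be the
  intersection of \<open>A\<close> with the \<open>i\<close>-th block and \<open>D = (\<Sum>i. dim A\<^sub>i) \<le> dim A\<close>. The copies contribute
  at most \<open>K * D\<close>. For the product, resample the \<open>i\<close>-th block given the others: it lies in \<open>A\<^sub>i\<close> if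
  \<open>A\<close> is the direct sum of the \<open>A\<^sub>i\<close>, and otherwise in a coset of \<open>A\<^sub>i\<close>, which spans at most one
  more dimension. So the product has mass at most \<open>K * (dim A\<^sub>i + dim A - D)\<close> for every \<open>i\<close>, hence
  at most \<open>K * (D / a + dim A - D)\<close>. The induction starts from \<open>n = 1\<close>, since every distribution
  with \<open>\<mu> 0 = 0\<close> is 1-spread.
\<close>

section \<open>Finite vector spaces\<close>

lemma (in vector_space) card_span_independent:
  assumes "finite B" and "independent B"
  shows "card (span B) = CARD('a) ^ card B"
  using assms
proof (induction B)
  case empty
  then show ?case by simp
next
  case (insert v B)
  then have v: "v \<notin> span B" and B: "independent B" by (auto simp: independent_insert)
  let ?f = "\<lambda>(c, x). c *s v + x"
  have "span (insert v B) = ?f ` (UNIV \<times> span B)"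
  proof (intro set_eqI iffI)
    fix x assume "x \<in> span (insert v B)"
    then obtain c where "x - c *s v \<in> span B" by (auto simp: span_insert)
    then show "x \<in> ?f ` (UNIV \<times> span B)" by (intro image_eqI [where x = "(c, x - c *s v)"]) auto
  next
    fix x assume "x \<in> ?f ` (UNIV \<times> span B)"
    then obtain c y where "y \<in> span B" "x = c *s v + y" by auto
    then have "x - c *s v \<in> span B" by simp
    then show "x \<in> span (insert v B)" by (auto simp: span_insert)
  qed
  moreover have "inj_on ?f (UNIV \<times> span B)"
  proof (clarsimp simp: inj_on_def)
    fix c x d y assume x: "x \<in> span B" and y: "y \<in> span B" and eq: "c *s v + x = d *s v + y"
    then have "(c - d) *s v = y - x" by (simp add: algebra_simps)
    then have "(c - d) *s v \<in> span B" using x y by (simp add: span_diff)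
    then have "c = d"
      using v span_scale [of "(c - d) *s v" B "inverse (c - d)"] by (cases "c = d") auto
    with eq show "c = d \<and> x = y" by simp
  qed
  ultimately have "card (span (insert v B)) = CARD('a) * card (span B)"
    by (simp add: card_image card_cartesian_product)
  then show ?case using insert B by simp
qed

lemma (in vector_space) card_subspace:
  assumes "finite A" and "subspace A"
  shows "card A = CARD('a) ^ dim A"
proof -
  obtain B where B: "B \<subseteq> A" "independent B" "A \<subseteq> span B" "card B = dim A"
    using basis_exists by blast
  have "span B = A" using B(1,3) assms(2) by (rule span_subspace)
  then show ?thesis
    using card_span_independent [OF finite_subset [OF B(1) assms(1)] B(2)] B(4) by simp
qed

lemma (in vector_space) dim_insert_le:
  assumes "finite A"
  shows "dim (insert v A) \<le> Suc (dim A)"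
proof -
  obtain B where B: "B \<subseteq> A" "independent B" "A \<subseteq> span B" "card B = dim A"
    using basis_exists by blast
  have fin: "finite B" using B(1) assms by (rule finite_subset)
  have "insert v A \<subseteq> span (insert v B)"
    using B(3) span_mono [of B "insert v B"] span_base [of v "insert v B"] by auto
  then have "dim (insert v A) \<le> card (insert v B)" using fin by (intro dim_le_card) auto
  also have "\<dots> \<le> Suc (dim A)" using B(4) fin by (simp add: card_insert_if)
  finally show ?thesis .
qed

lemma UNIV_bit: "(UNIV :: bit set) = {0, 1}"
  using bit_not_zero_iff by blast

lemma card_F2_subspace:
  assumes "finite A" and "F2.subspace A"
  shows "card A = 2 ^ F2.dim A"
  using F2.card_subspace [OF assms] by (simp add: UNIV_bit numeral_2_eq_2)

lemma F2_dim_psubset: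
  assumes "F2.subspace A" and "F2.subspace B" and "finite B" and "A \<subset> B"
  shows "F2.dim A < F2.dim B"
proof -
  have "card A < card B" using assms(3,4) by (rule psubset_card_mono)
  moreover have "finite A" using assms(3,4) finite_subset by blast
  ultimately have "(2::nat) ^ F2.dim A < 2 ^ F2.dim B"
    using assms by (simp add: card_F2_subspace)
  then show ?thesis by (rule power_less_imp_less_exp [rotated]) simp
qed

lemma subspace_F2vec: "F2.subspace (F2vec n)"
  by (rule F2.subspaceI) (auto simp: F2vec_def F2scale_def)

lemmas zero_in_F2vec [simp] = F2.subspace_0 [OF subspace_F2vec]
  and add_in_F2vec [simp] = F2.subspace_add [OF subspace_F2vec]
  and diff_in_F2vec [simp] = F2.subspace_diff [OF subspace_F2vec]

lemma finite_F2vec [simp]: "finite (F2vec n)"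
proof -
  have "F2vec n = {x. \<forall>i. (i \<in> {..<n} \<longrightarrow> x i \<in> UNIV) \<and> (i \<notin> {..<n} \<longrightarrow> x i = 0)}"
    by (auto simp: F2vec_def)
  then show ?thesis
    using finite_set_of_finite_funs [of "{..<n}" "UNIV :: bit set" 0] by (simp add: UNIV_bit)
qed


section \<open>Blocks of coordinates\<close>

definition embed_block :: "nat \<Rightarrow> nat \<Rightarrow> (nat \<Rightarrow> bit) \<Rightarrow> nat \<Rightarrow> bit" where
  "embed_block m i u = (\<lambda>k. if k div m = i then u (k mod m) else 0)"

interpretation block: Vector_Spaces.linear F2scale F2scale "block m i" for m i
  by unfold_locales (auto simp: block_def F2scale_def)

interpretation embed_block: Vector_Spaces.linear F2scale F2scale "embed_block m i" for m i
  by unfold_locales (auto simp: embed_block_def F2scale_def)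

lemma block_in_F2vec [simp]: "block m i x \<in> F2vec m"
  by (simp add: block_def F2vec_def)

lemma embed_block_in_F2vec [simp]:
  assumes "u \<in> F2vec m" and "i < a"
  shows "embed_block m i u \<in> F2vec (a * m)"
proof -
  have "embed_block m i u k = 0" if "k \<ge> a * m" for k
  proof (cases "m = 0")
    case True
    then show ?thesis using assms(1) by (simp add: embed_block_def F2vec_def)
  next
    case False
    then have "a \<le> k div m" using that by (simp add: less_eq_div_iff_mult_less_eq)
    then show ?thesis using assms(2) by (simp add: embed_block_def)
  qed
  then show ?thesis by (simp add: F2vec_def)
qed

lemma block_embed_block:
  assumes "u \<in> F2vec m"
  shows "block m j (embed_block m i u) = (if j = i then u else 0)"
  using assms by (auto simp: block_def embed_block_def F2vec_def fun_eq_iff)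

lemma sum_fun_apply: "(\<Sum>j\<in>J. f j) x = (\<Sum>j\<in>J. f j x)"
  by (induction J rule: infinite_finite_induct) simp_all

lemma sum_embed_block_block:
  assumes "x \<in> F2vec (a * m)"
  shows "(\<Sum>i<a. embed_block m i (block m i x)) = x"
proof
  fix k
  have "(\<Sum>i<a. embed_block m i (block m i x)) k
      = (\<Sum>i<a. if i = k div m then block m i x (k mod m) else 0)"
    unfolding sum_fun_apply by (intro sum.cong) (auto simp: embed_block_def)
  also have "\<dots> = (if k div m < a then block m (k div m) x (k mod m) else 0)"
    by simp
  also have "\<dots> = x k"
  proof (cases "k < a * m")
    case True
    then have "0 < m" by (cases m) auto
    then show ?thesis using True by (simp add: block_def less_mult_imp_div_less)
  next
    case False
    then have "x k = 0" using assms by (simp add: F2vec_def)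
    then show ?thesis by (simp add: block_def)
  qed
  finally show "(\<Sum>i<a. embed_block m i (block m i x)) k = x k" .
qed

lemma block_sum_embed_block:
  assumes "\<And>i. i < a \<Longrightarrow> X i \<in> F2vec m" and "j < a"
  shows "block m j (\<Sum>i<a. embed_block m i (X i)) = X j"
proof -
  have "block m j (\<Sum>i<a. embed_block m i (X i)) = (\<Sum>i<a. if i = j then X j else 0)"
    unfolding block.sum using assms(1) by (intro sum.cong) (auto simp: block_embed_block)
  also have "\<dots> = X j" using assms(2) by simp
  finally show ?thesis .
qed

lemma bij_betw_blocks:
  "bij_betw (\<lambda>X. \<Sum>i<a. embed_block m i (X i)) ({..<a} \<rightarrow>\<^sub>E F2vec m) (F2vec (a * m))"
proof (rule bij_betw_byWitness [where f' = "\<lambda>x. \<lambda>i\<in>{..<a}. block m i x"])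
  show "\<forall>X\<in>{..<a} \<rightarrow>\<^sub>E F2vec m. (\<lambda>i\<in>{..<a}. block m i (\<Sum>i<a. embed_block m i (X i))) = X"
  proof
    fix X assume X: "X \<in> {..<a} \<rightarrow>\<^sub>E F2vec m"
    then have "block m j (\<Sum>i<a. embed_block m i (X i)) = X j" if "j < a" for j
      using that by (intro block_sum_embed_block) auto
    then show "(\<lambda>i\<in>{..<a}. block m i (\<Sum>i<a. embed_block m i (X i))) = X"
      by (intro ext) (use PiE_arb [OF X] in \<open>auto simp: restrict_def\<close>)
  qed
  show "(\<lambda>X. \<Sum>i<a. embed_block m i (X i)) ` ({..<a} \<rightarrow>\<^sub>E F2vec m) \<subseteq> F2vec (a * m)"
    by (auto intro!: F2.subspace_sum [OF subspace_F2vec] embed_block_in_F2vec)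
qed (simp_all add: sum_embed_block_block image_subset_iff)

lemma sum_prod_block:
  fixes h :: "nat \<Rightarrow> (nat \<Rightarrow> bit) \<Rightarrow> 'a :: comm_semiring_1"
  shows "(\<Sum>x\<in>F2vec (a * m). \<Prod>i<a. h i (block m i x)) = (\<Prod>i<a. \<Sum>u\<in>F2vec m. h i u)"
proof -
  have "(\<Sum>x\<in>F2vec (a * m). \<Prod>i<a. h i (block m i x))
      = (\<Sum>X\<in>{..<a} \<rightarrow>\<^sub>E F2vec m. \<Prod>j<a. h j (block m j (\<Sum>i<a. embed_block m i (X i))))"
    by (rule sum.reindex_bij_betw [OF bij_betw_blocks, symmetric])
  also have "\<dots> = (\<Sum>X\<in>{..<a} \<rightarrow>\<^sub>E F2vec m. \<Prod>j<a. h j (X j))"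
    by (intro sum.cong prod.cong refl arg_cong [where f = "h _"] block_sum_embed_block) auto
  also have "\<dots> = (\<Prod>i<a. \<Sum>u\<in>F2vec m. h i u)"
    by (rule prod_sum_PiE [symmetric]) auto
  finally show ?thesis .
qed

lemma card_F2vec_mult: "card (F2vec (a * m)) = card (F2vec m) ^ a"
  using sum_prod_block [where h = "\<lambda>_ _. 1 :: nat" and a = a and m = m] by simp

definition set_block :: "nat \<Rightarrow> nat \<Rightarrow> (nat \<Rightarrow> bit) \<Rightarrow> (nat \<Rightarrow> bit) \<Rightarrow> nat \<Rightarrow> bit" where
  "set_block m i u x = x + embed_block m i (u - block m i x)"

lemma set_block_in_F2vec [simp]:
  "x \<in> F2vec (a * m) \<Longrightarrow> u \<in> F2vec m \<Longrightarrow> i < a \<Longrightarrow> set_block m i u x \<in> F2vec (a * m)"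
  by (simp add: set_block_def)

lemma block_set_block:
  "u \<in> F2vec m \<Longrightarrow> block m j (set_block m i u x) = (if j = i then u else block m j x)"
  by (simp add: set_block_def block.add block_embed_block)

lemma set_block_set_block:
  "u \<in> F2vec m \<Longrightarrow> set_block m i v (set_block m i u x) = set_block m i v x"
  by (simp add: set_block_def block.add block_embed_block) (simp add: embed_block.diff)

lemma set_block_same [simp]: "set_block m i (block m i x) x = x"
  by (simp add: set_block_def)

lemma set_block_diff: "set_block m i u x - set_block m i v x = embed_block m i (u - v)"
  by (simp add: set_block_def embed_block.diff)

(* Exchanging the i-th block of x with u is an involution that preserves the weight. *)
lemma sum_prod_block_resample:
  fixes \<mu> :: "(nat \<Rightarrow> bit) \<Rightarrow> real"
  assumes "i < a" and "sum \<mu> (F2vec m) = 1"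
  shows "(\<Sum>x\<in>F2vec (a * m). \<phi> x * (\<Prod>j<a. \<mu> (block m j x)))
    = (\<Sum>x\<in>F2vec (a * m). (\<Prod>j<a. \<mu> (block m j x)) * (\<Sum>u\<in>F2vec m. \<phi> (set_block m i u x) * \<mu> u))"
proof -
  let ?X = "F2vec (a * m) \<times> F2vec m"
  let ?P = "\<lambda>x. \<Prod>j<a. \<mu> (block m j x)"
  let ?exchange = "\<lambda>(x, u). (set_block m i u x, block m i x)"
  have weight: "?P (set_block m i u x) * \<mu> (block m i x) = ?P x * \<mu> u" if "u \<in> F2vec m" for x u
    using assms(1) that by (simp add: prod.remove [of _ i] block_set_block)
  have bij: "bij_betw ?exchange ?X ?X"
    by (rule bij_betw_byWitness [where f' = ?exchange])
      (use assms(1) in \<open>auto simp: block_set_block set_block_set_block\<close>)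
  have "(\<Sum>x\<in>F2vec (a * m). \<phi> x * ?P x) = (\<Sum>x\<in>F2vec (a * m). \<Sum>u\<in>F2vec m. \<phi> x * ?P x * \<mu> u)"
    using assms(2) by (simp add: sum_distrib_left [symmetric])
  also have "\<dots> = (\<Sum>(x, u)\<in>?X. \<phi> x * (?P x * \<mu> u))"
    by (simp add: sum.cartesian_product mult.assoc)
  also have "\<dots> = (\<Sum>(x, u)\<in>?X. \<phi> (set_block m i u x) * (?P (set_block m i u x) * \<mu> (block m i x)))"
    by (subst sum.reindex_bij_betw [OF bij, symmetric]) (simp add: case_prod_beta)
  also have "\<dots> = (\<Sum>(x, u)\<in>?X. \<phi> (set_block m i u x) * (?P x * \<mu> u))"
    by (intro sum.cong refl) (auto simp: weight)
  also have "\<dots> = (\<Sum>x\<in>F2vec (a * m). ?P x * (\<Sum>u\<in>F2vec m. \<phi> (set_block m i u x) * \<mu> u))"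
    by (simp add: sum.cartesian_product [symmetric] sum_distrib_left mult.left_commute)
  finally show ?thesis .
qed


section \<open>Slices of a subspace\<close>

definition slice :: "nat \<Rightarrow> nat \<Rightarrow> (nat \<Rightarrow> bit) set \<Rightarrow> (nat \<Rightarrow> bit) set" where
  "slice m i A = {u \<in> F2vec m. embed_block m i u \<in> A}"

definition slice_product :: "nat \<Rightarrow> nat \<Rightarrow> (nat \<Rightarrow> bit) set \<Rightarrow> (nat \<Rightarrow> bit) set" where
  "slice_product a m A = {x \<in> F2vec (a * m). \<forall>i<a. block m i x \<in> slice m i A}"

lemma slice_subset: "slice m i A \<subseteq> F2vec m"
  by (auto simp: slice_def)

lemma finite_slice [simp]: "finite (slice m i A)"
  using slice_subset finite_F2vec by (rule finite_subset)

lemma slice_F2vec: "i < a \<Longrightarrow> slice m i (F2vec (a * m)) = F2vec m"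
  by (auto simp: slice_def)

lemma subspace_slice:
  assumes "F2.subspace A"
  shows "F2.subspace (slice m i A)"
proof -
  have "slice m i A = F2vec m \<inter> embed_block m i -` A" by (auto simp: slice_def)
  then show ?thesis
    using F2.subspace_inter [OF subspace_F2vec embed_block.subspace_vimage [OF assms]] by simp
qed

lemma subspace_slice_product:
  assumes "F2.subspace A"
  shows "F2.subspace (slice_product a m A)"
proof -
  have "slice_product a m A = F2vec (a * m) \<inter> (\<Inter>i\<in>{..<a}. block m i -` slice m i A)"
    by (auto simp: slice_product_def)
  moreover have "F2.subspace (\<Inter>i\<in>{..<a}. block m i -` slice m i A)"
    by (intro F2.subspace_Int block.subspace_vimage subspace_slice assms)
  ultimately show ?thesis by (simp add: F2.subspace_inter subspace_F2vec)
qed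

lemma slice_product_subset:
  assumes "F2.subspace A"
  shows "slice_product a m A \<subseteq> A"
proof
  fix x assume x: "x \<in> slice_product a m A"
  then have "(\<Sum>i<a. embed_block m i (block m i x)) \<in> A"
    by (intro F2.subspace_sum [OF assms]) (auto simp: slice_product_def slice_def)
  then show "x \<in> A" using x by (simp add: sum_embed_block_block slice_product_def)
qed

lemma card_slice_product: "card (slice_product a m A) = (\<Prod>i<a. card (slice m i A))"
proof -
  have indicator: "of_bool (\<forall>i<a. block m i x \<in> slice m i A)
      = (\<Prod>i<a. of_bool (block m i x \<in> slice m i A) :: nat)" for x
    by (auto simp: of_bool_def)
  have "card (slice_product a m A)
      = (\<Sum>x\<in>F2vec (a * m). \<Prod>i<a. of_bool (block m i x \<in> slice m i A))"
    by (simp add: indicator [symmetric] slice_product_def Int_def)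
  also have "\<dots> = (\<Prod>i<a. \<Sum>u\<in>F2vec m. of_bool (u \<in> slice m i A))"
    by (rule sum_prod_block)
  also have "\<dots> = (\<Prod>i<a. card (slice m i A))"
    using slice_subset by (simp add: Int_absorb1)
  finally show ?thesis .
qed

lemma dim_slice_product:
  assumes "F2.subspace A"
  shows "F2.dim (slice_product a m A) = (\<Sum>i<a. F2.dim (slice m i A))"
proof -
  have "finite (slice_product a m A)" by (simp add: slice_product_def)
  then have "(2::nat) ^ F2.dim (slice_product a m A) = (\<Prod>i<a. card (slice m i A))"
    using assms card_slice_product by (metis card_F2_subspace subspace_slice_product)
  also have "\<dots> = 2 ^ (\<Sum>i<a. F2.dim (slice m i A))"
    using assms by (simp add: card_F2_subspace subspace_slice power_sum)
  finally show ?thesis by simp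
qed

lemma sum_dim_slice_less:
  assumes "F2.subspace A" and "finite A" and "A \<noteq> slice_product a m A"
  shows "(\<Sum>i<a. F2.dim (slice m i A)) < F2.dim A"
proof -
  have "slice_product a m A \<subset> A" using slice_product_subset [OF assms(1)] assms(3) by blast
  then show ?thesis
    using F2_dim_psubset [OF subspace_slice_product assms(1,2)] assms(1)
    by (simp add: dim_slice_product)
qed

lemma sum_dim_slice_le:
  assumes "F2.subspace A" and "finite A"
  shows "(\<Sum>i<a. F2.dim (slice m i A)) \<le> F2.dim A"
  using sum_dim_slice_less [OF assms] dim_slice_product [OF assms(1)]
  by (metis less_imp_le order_refl)


section \<open>Spread distributions\<close>

locale spread_distribution =
  fixes n :: nat and \<mu> :: "(nat \<Rightarrow> bit) \<Rightarrow> real" and K :: real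
  assumes nonneg: "0 \<le> \<mu> S"
    and total: "sum \<mu> (F2vec n) = 1"
    and sum_subspace_le: "F2.subspace A \<Longrightarrow> A \<subseteq> F2vec n \<Longrightarrow> sum \<mu> A \<le> K * F2.dim A"
begin

lemma K_nonneg: "0 \<le> K"
proof -
  have "1 \<le> K * F2.dim (F2vec n)"
    using sum_subspace_le [OF subspace_F2vec order_refl] total by simp
  then have "0 < K * F2.dim (F2vec n)" by linarith
  then show ?thesis by (auto simp: zero_less_mult_iff)
qed

lemma weight_0: "\<mu> 0 = 0"
proof -
  have "F2.dim {0} = 0" by (rule F2.dim_unique [of "{}"]) (auto simp: F2.independent_empty)
  then have "\<mu> 0 \<le> 0" using sum_subspace_le [of "{0}"] by simp
  then show ?thesis using nonneg [of 0] by simp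
qed

lemma sum_coset_le:
  assumes "F2.subspace A" and "A \<subseteq> F2vec n" and "v \<in> F2vec n"
  shows "sum \<mu> ((+) v ` A) \<le> K * (F2.dim A + 1)"
proof -
  let ?C = "F2.span (insert v A)"
  have sub: "?C \<subseteq> F2vec n"
    using assms(2,3) by (intro F2.span_minimal subspace_F2vec) auto
  have "(+) v ` A \<subseteq> ?C" by (auto intro: F2.span_add F2.span_base)
  then have "sum \<mu> ((+) v ` A) \<le> sum \<mu> ?C"
    using sub nonneg by (intro sum_mono2) (auto intro: finite_subset)
  also have "\<dots> \<le> K * F2.dim ?C" using sub by (intro sum_subspace_le) auto
  also have "\<dots> \<le> K * (F2.dim A + 1)"
    using F2.dim_insert_le [of A v] finite_subset [OF assms(2)] K_nonneg
    by (intro mult_left_mono) auto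
  finally show ?thesis .
qed

lemma sum_prod_block_le_fibres:
  assumes "i < a" and "A \<subseteq> F2vec (a * n)"
    and fibre: "\<And>x. x \<in> F2vec (a * n) \<Longrightarrow> sum \<mu> {u \<in> F2vec n. set_block n i u x \<in> A} \<le> R"
  shows "(\<Sum>x\<in>A. \<Prod>j<a. \<mu> (block n j x)) \<le> R"
proof -
  let ?P = "\<lambda>x. \<Prod>j<a. \<mu> (block n j x)"
  have "sum ?P A = (\<Sum>x\<in>F2vec (a * n). of_bool (x \<in> A) * ?P x)"
    using assms(2) by (simp add: Int_absorb1)
  also have "\<dots> = (\<Sum>x\<in>F2vec (a * n). ?P x * (\<Sum>u\<in>F2vec n. of_bool (set_block n i u x \<in> A) * \<mu> u))"
    by (rule sum_prod_block_resample [OF assms(1) total])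
  also have "\<dots> = (\<Sum>x\<in>F2vec (a * n). ?P x * sum \<mu> {u \<in> F2vec n. set_block n i u x \<in> A})"
    by (simp add: Int_def)
  also have "\<dots> \<le> (\<Sum>x\<in>F2vec (a * n). ?P x * R)"
    using fibre nonneg by (intro sum_mono mult_left_mono prod_nonneg) auto
  also have "\<dots> = R"
    using total by (simp add: sum_distrib_right [symmetric] sum_prod_block [where h = "\<lambda>_. \<mu>"])
  finally show ?thesis .
qed

lemma sum_fibre_le:
  assumes A: "F2.subspace A" and x: "x \<in> F2vec (a * n)"
  shows "sum \<mu> {u \<in> F2vec n. set_block n i u x \<in> A} \<le> K * (F2.dim (slice n i A) + 1)"
    (is "sum \<mu> ?F \<le> ?R")
proof (cases "?F = {}")
  case True
  then show ?thesis using K_nonneg by (simp only: sum.empty) simp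
next
  case False
  then obtain v where v: "v \<in> F2vec n" "set_block n i v x \<in> A" by blast
  have "?F \<subseteq> (+) v ` slice n i A"
  proof
    fix u assume u: "u \<in> ?F"
    then have "u - v \<in> slice n i A"
      using v F2.subspace_diff [OF A, of "set_block n i u x" "set_block n i v x"]
      by (simp add: set_block_diff slice_def)
    then show "u \<in> (+) v ` slice n i A" by (intro image_eqI [where x = "u - v"]) simp
  qed
  then have "sum \<mu> ?F \<le> sum \<mu> ((+) v ` slice n i A)"
    using nonneg by (intro sum_mono2) auto
  also have "\<dots> \<le> ?R" using A v(1) by (intro sum_coset_le subspace_slice slice_subset)
  finally show ?thesis .
qed

lemma sum_prod_block_le_dim:
  assumes A: "F2.subspace A" "A \<subseteq> F2vec (a * n)" and i: "i < a"
  defines "D \<equiv> \<Sum>j<a. F2.dim (slice n j A)"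
  shows "(\<Sum>x\<in>A. \<Prod>j<a. \<mu> (block n j x)) \<le> K * (real (F2.dim (slice n i A)) + F2.dim A - D)"
proof (rule sum_prod_block_le_fibres [OF i A(2)])
  fix x assume x: "x \<in> F2vec (a * n)"
  let ?F = "{u \<in> F2vec n. set_block n i u x \<in> A}"
  show "sum \<mu> ?F \<le> K * (real (F2.dim (slice n i A)) + F2.dim A - D)"
  proof (cases "A = slice_product a n A")
    case True
    then have D: "D = F2.dim A" using dim_slice_product [OF A(1), of a n] by (simp add: D_def)
    have "?F \<subseteq> slice n i A"
    proof
      fix u assume u: "u \<in> ?F"
      then have "set_block n i u x \<in> slice_product a n A" using True by blast
      then show "u \<in> slice n i A" using u i by (auto simp: slice_product_def block_set_block)
    qed
    then have "sum \<mu> ?F \<le> sum \<mu> (slice n i A)" using nonneg by (intro sum_mono2) auto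
    also have "\<dots> \<le> K * F2.dim (slice n i A)"
      using A(1) by (intro sum_subspace_le subspace_slice slice_subset)
    finally show ?thesis using D by simp
  next
    case False
    then have "D < F2.dim A"
      using sum_dim_slice_less A finite_subset [OF A(2)] by (simp add: D_def)
    have "sum \<mu> ?F \<le> K * (F2.dim (slice n i A) + 1)" using A(1) x by (rule sum_fibre_le)
    also have "\<dots> \<le> K * (real (F2.dim (slice n i A)) + F2.dim A - D)"
      using \<open>D < F2.dim A\<close> K_nonneg by (intro mult_left_mono) auto
    finally show ?thesis .
  qed
qed

lemma sum_prod_block_le_average:
  assumes "F2.subspace A" and "A \<subseteq> F2vec (a * n)"
  defines "D \<equiv> \<Sum>i<a. F2.dim (slice n i A)"
  shows "a * (\<Sum>x\<in>A. \<Prod>i<a. \<mu> (block n i x)) \<le> K * (D + a * (real (F2.dim A) - D))"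
proof -
  have "a * (\<Sum>x\<in>A. \<Prod>i<a. \<mu> (block n i x)) = (\<Sum>j<a. \<Sum>x\<in>A. \<Prod>i<a. \<mu> (block n i x))"
    by simp
  also have "\<dots> \<le> (\<Sum>j<a. K * (real (F2.dim (slice n j A)) + F2.dim A - D))"
    unfolding D_def using assms(1,2) by (intro sum_mono sum_prod_block_le_dim) auto
  also have "\<dots> = K * (D + a * (real (F2.dim A) - D))"
    by (simp add: D_def sum_distrib_left [symmetric] sum.distrib sum_subtractf algebra_simps)
  finally show ?thesis .
qed

end

definition supported_on_block :: "nat \<Rightarrow> nat \<Rightarrow> nat \<Rightarrow> (nat \<Rightarrow> bit) \<Rightarrow> bool" where
  "supported_on_block a m i x \<longleftrightarrow> (\<forall>j\<in>{..<a} - {i}. block m j x = 0)"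

definition block_mixture :: "nat \<Rightarrow> nat \<Rightarrow> ((nat \<Rightarrow> bit) \<Rightarrow> real) \<Rightarrow> (nat \<Rightarrow> bit) \<Rightarrow> real" where
  "block_mixture a m \<mu> x =
     ((\<Sum>i<a. of_bool (supported_on_block a m i x) * \<mu> (block m i x))
        + (\<Prod>i<a. \<mu> (block m i x))) / (real a + 1)"

lemma embed_block_image_slice:
  assumes "A \<subseteq> F2vec (a * m)" and i: "i < a"
  shows "embed_block m i ` slice m i A = {x \<in> A. supported_on_block a m i x}"
proof (intro set_eqI iffI)
  fix x assume "x \<in> {x \<in> A. supported_on_block a m i x}"
  then have x: "x \<in> A" "\<And>j. j \<in> {..<a} - {i} \<Longrightarrow> block m j x = 0"
    by (auto simp: supported_on_block_def)
  have "x = (\<Sum>j<a. embed_block m j (block m j x))"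
    using x(1) assms(1) by (intro sum_embed_block_block [symmetric]) auto
  also have "\<dots> = embed_block m i (block m i x)"
    using i x(2) by (subst sum.remove [of _ i]) (auto simp: embed_block.zero)
  finally have "x = embed_block m i (block m i x)" .
  moreover from this x(1) have "block m i x \<in> slice m i A" by (simp add: slice_def)
  ultimately show "x \<in> embed_block m i ` slice m i A" by (rule image_eqI)
qed (auto simp: slice_def supported_on_block_def block_embed_block)

lemma sum_block_mixture:
  assumes "A \<subseteq> F2vec (a * m)"
  shows "(real a + 1) * sum (block_mixture a m \<mu>) A
    = (\<Sum>i<a. sum \<mu> (slice m i A)) + (\<Sum>x\<in>A. \<Prod>i<a. \<mu> (block m i x))"
proof -
  have fin: "finite A" using assms finite_F2vec by (rule finite_subset)
  have single: "(\<Sum>x\<in>A. of_bool (supported_on_block a m i x) * \<mu> (block m i x))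
      = sum \<mu> (slice m i A)" if "i < a" for i
  proof -
    have inj: "inj_on (embed_block m i) (slice m i A)"
      by (rule inj_on_inverseI [where g = "block m i"]) (auto simp: slice_def block_embed_block)
    have "(\<Sum>x\<in>A. of_bool (supported_on_block a m i x) * \<mu> (block m i x))
        = (\<Sum>x\<in>embed_block m i ` slice m i A. \<mu> (block m i x))"
      using fin by (simp add: embed_block_image_slice [OF assms that] Int_def)
    also have "\<dots> = sum \<mu> (slice m i A)"
      by (subst sum.reindex [OF inj]) (auto simp: slice_def block_embed_block intro!: sum.cong)
    finally show ?thesis .
  qed
  have "(real a + 1) * sum (block_mixture a m \<mu>) A
      = (\<Sum>x\<in>A. \<Sum>i<a. of_bool (supported_on_block a m i x) * \<mu> (block m i x))
        + (\<Sum>x\<in>A. \<Prod>i<a. \<mu> (block m i x))"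
    by (simp add: block_mixture_def sum_divide_distrib [symmetric] sum.distrib add_eq_0_iff)
  also have "(\<Sum>x\<in>A. \<Sum>i<a. of_bool (supported_on_block a m i x) * \<mu> (block m i x))
      = (\<Sum>i<a. sum \<mu> (slice m i A))"
    by (subst sum.swap) (simp add: single)
  finally show ?thesis .
qed

theorem (in spread_distribution) spread_distribution_block_mixture:
  assumes "0 < a"
  shows "spread_distribution (a * n) (block_mixture a n \<mu>) (K / a)"
proof
  show "0 \<le> block_mixture a n \<mu> x" for x
    unfolding block_mixture_def using nonneg
    by (intro divide_nonneg_nonneg add_nonneg_nonneg sum_nonneg prod_nonneg mult_nonneg_nonneg) auto
  have "(real a + 1) * sum (block_mixture a n \<mu>) (F2vec (a * n)) = real a + 1"
    by (subst sum_block_mixture)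
      (simp_all add: slice_F2vec total sum_prod_block [where h = "\<lambda>_. \<mu>"])
  then show "sum (block_mixture a n \<mu>) (F2vec (a * n)) = 1" by simp
next
  fix A assume A: "F2.subspace A" "A \<subseteq> F2vec (a * n)"
  define D where "D = (\<Sum>i<a. F2.dim (slice n i A))"
  have D_le: "D \<le> F2.dim A"
    unfolding D_def using A finite_subset by (blast intro: sum_dim_slice_le finite_F2vec)
  have copies: "(\<Sum>i<a. sum \<mu> (slice n i A)) \<le> K * D"
    unfolding D_def of_nat_sum sum_distrib_left
    using A(1) by (intro sum_mono sum_subspace_le subspace_slice slice_subset)
  have "a * ((real a + 1) * sum (block_mixture a n \<mu>) A)
      = a * (\<Sum>i<a. sum \<mu> (slice n i A)) + a * (\<Sum>x\<in>A. \<Prod>i<a. \<mu> (block n i x))"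
    by (simp only: sum_block_mixture [OF A(2)] distrib_left)
  also have "\<dots> \<le> a * (K * D) + K * (D + a * (real (F2.dim A) - D))"
    using copies sum_prod_block_le_average [OF A]
    by (intro add_mono mult_left_mono) (auto simp: D_def)
  also have "\<dots> = K * (a * F2.dim A + D)" by (simp add: algebra_simps)
  also have "\<dots> \<le> K * (a * F2.dim A + F2.dim A)"
    using D_le K_nonneg by (intro mult_left_mono) auto
  also have "\<dots> = (real a + 1) * (K * F2.dim A)" by (simp add: algebra_simps)
  finally have "(real a + 1) * (a * sum (block_mixture a n \<mu>) A) \<le> (real a + 1) * (K * F2.dim A)"
    by (simp only: mult.left_commute)
  then have "a * sum (block_mixture a n \<mu>) A \<le> K * F2.dim A"
    by (rule mult_left_le_imp_le) simp
  then show "sum (block_mixture a n \<mu>) A \<le> K / a * F2.dim A"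
    using assms by (simp add: field_simps)
qed

lemma spread_distribution_1:
  assumes "\<And>S. 0 \<le> \<mu> S" and "sum \<mu> (F2vec n) = 1" and "\<mu> 0 = 0"
  shows "spread_distribution n \<mu> 1"
proof
  fix A assume A: "F2.subspace A" "A \<subseteq> F2vec n"
  have fin: "finite A" using A(2) finite_F2vec by (rule finite_subset)
  show "sum \<mu> A \<le> 1 * real (F2.dim A)"
  proof (cases "F2.dim A = 0")
    case True
    then have "card A = 1" using card_F2_subspace [OF fin A(1)] by simp
    then have "A = {0}" using F2.subspace_0 [OF A(1)] by (auto simp: card_1_singleton_iff)
    then show ?thesis using assms(3) by simp
  next
    case False
    have "sum \<mu> A \<le> sum \<mu> (F2vec n)" using A(2) assms(1) by (intro sum_mono2) auto
    then show ?thesis using False assms(2) by simp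
  qed
qed (use assms in auto)


section \<open>Fourier coefficients\<close>

definition character :: "nat \<Rightarrow> (nat \<Rightarrow> bit) \<Rightarrow> (nat \<Rightarrow> bit) \<Rightarrow> real" where
  "character n S x = bit_sign (\<Sum>i<n. S i * x i)"

lemma fourier_coeff_conv_character:
  "fourier_coeff n f S = (\<Sum>x\<in>F2vec n. f x * character n S x) / card (F2vec n)"
  by (simp add: fourier_coeff_def character_def)

lemma bit_sign_0 [simp]: "bit_sign 0 = 1"
  by (simp add: bit_sign_def)

lemma bit_sign_add: "bit_sign (a + b) = bit_sign a * bit_sign b"
  by (cases a; cases b) (auto simp: bit_sign_def)

lemma bit_sign_sum: "bit_sign (\<Sum>i\<in>I. f i) = (\<Prod>i\<in>I. bit_sign (f i))"
  by (induction I rule: infinite_finite_induct)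
    (simp_all only: sum.infinite prod.infinite sum.empty prod.empty sum.insert prod.insert
      bit_sign_0 bit_sign_add simp_thms)

lemma character_0 [simp]: "character n 0 x = 1"
  by (simp add: character_def)

lemma character_add_left: "character n (S + T) x = character n S x * character n T x"
  by (simp only: character_def plus_fun_apply distrib_right sum.distrib bit_sign_add)

lemma character_add_right: "character n S (x + y) = character n S x * character n S y"
  by (simp only: character_def plus_fun_apply distrib_left sum.distrib bit_sign_add)

lemma character_blocks: "character (a * m) S x = (\<Prod>i<a. character m (block m i S) (block m i x))"
proof -
  have "(\<Sum>k<a * m. S k * x k) = (\<Sum>i<a. \<Sum>k\<in>{i * m..<i * m + m}. S k * x k)"
    by (rule sum.nat_group [symmetric])
  also have "\<dots> = (\<Sum>i<a. \<Sum>k<m. block m i S k * block m i x k)"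
  proof (rule sum.cong [OF refl])
    fix i
    show "(\<Sum>k\<in>{i * m..<i * m + m}. S k * x k) = (\<Sum>k<m. block m i S k * block m i x k)"
      using sum.shift_bounds_nat_ivl [of "\<lambda>k. S k * x k" 0 "i * m" m]
      by (simp add: block_def atLeast0LessThan add.commute)
  qed
  finally show ?thesis by (simp only: character_def bit_sign_sum [symmetric])
qed

lemma sum_character:
  assumes "S \<in> F2vec n"
  shows "(\<Sum>x\<in>F2vec n. character n S x) = of_bool (S = 0) * card (F2vec n)"
proof (cases "S = 0")
  case False
  then obtain j where j: "S j \<noteq> 0" by (auto simp: fun_eq_iff)
  with assms have "j < n" by (auto simp: F2vec_def not_le [symmetric])
  define e :: "nat \<Rightarrow> bit" where "e = (\<lambda>i. of_bool (i = j))"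
  have e: "e \<in> F2vec n" using \<open>j < n\<close> by (auto simp: e_def F2vec_def)
  have "S i * e i = (if i = j then S j else 0)" for i by (simp add: e_def)
  then have "character n S e = - 1"
    using j \<open>j < n\<close> by (simp add: character_def bit_sign_def)
  have "bij_betw ((+) e) (F2vec n) (F2vec n)"
    by (rule bij_betw_byWitness [where f' = "\<lambda>x. x - e"]) (use e in auto)
  then have "(\<Sum>x\<in>F2vec n. character n S x) = (\<Sum>x\<in>F2vec n. character n S (e + x))"
    by (rule sum.reindex_bij_betw [symmetric])
  also have "\<dots> = - (\<Sum>x\<in>F2vec n. character n S x)"
    by (simp add: character_add_right \<open>character n S e = - 1\<close> sum_negf)
  finally show ?thesis using False by simp
qed simp

lemma fourier_coeff_character:
  assumes "S \<in> F2vec n" and "T \<in> F2vec n"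
  shows "fourier_coeff n (character n T) S = of_bool (S = T)"
proof -
  have "S - T = T + S" by (simp add: fun_eq_iff add.commute)
  then have "T + S = 0 \<longleftrightarrow> S = T" by (metis right_minus_eq)
  moreover have "card (F2vec n) \<noteq> 0"
    using zero_in_F2vec by (metis card_0_eq empty_iff finite_F2vec)
  ultimately show ?thesis
    using assms
    by (simp add: fourier_coeff_conv_character character_add_left [symmetric] sum_character)
qed

lemma fourier_coeff_prod_block:
  "fourier_coeff (a * m) (\<lambda>x. \<Prod>i<a. h i (block m i x)) S
     = (\<Prod>i<a. fourier_coeff m (h i) (block m i S))"
proof -
  have "(\<Sum>x\<in>F2vec (a * m). (\<Prod>i<a. h i (block m i x)) * character (a * m) S x)
      = (\<Sum>x\<in>F2vec (a * m). \<Prod>i<a. h i (block m i x) * character m (block m i S) (block m i x))"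
    by (simp add: character_blocks prod.distrib)
  also have "\<dots> = (\<Prod>i<a. \<Sum>u\<in>F2vec m. h i u * character m (block m i S) u)"
    by (rule sum_prod_block)
  finally show ?thesis
    by (simp add: fourier_coeff_conv_character card_F2vec_mult prod_dividef)
qed

lemma fourier_coeff_block:
  assumes i: "i < a"
  shows "fourier_coeff (a * m) (\<lambda>x. g (block m i x)) S
    = of_bool (supported_on_block a m i S) * fourier_coeff m g (block m i S)"
proof -
  define h where "h j = (if j = i then g else character m 0)" for j
  have "g (block m i x) = (\<Prod>j<a. h j (block m j x))" for x
    using i by (simp add: prod.remove [of _ i] h_def)
  then have "fourier_coeff (a * m) (\<lambda>x. g (block m i x)) S
      = (\<Prod>j<a. fourier_coeff m (h j) (block m j S))"
    by (simp add: fourier_coeff_prod_block)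
  also have "\<dots> = fourier_coeff m g (block m i S)
      * (\<Prod>j\<in>{..<a} - {i}. of_bool (block m j S = 0))"
    using i by (simp add: prod.remove [of _ i] h_def fourier_coeff_character)
  also have "(\<Prod>j\<in>{..<a} - {i}. of_bool (block m j S = 0))
      = (of_bool (supported_on_block a m i S) :: real)"
    by (auto simp: supported_on_block_def of_bool_def)
  finally show ?thesis by simp
qed


section \<open>Iterated majority\<close>

lemma Maj3_fourier_expansion:
  "Maj3 z = ((\<Sum>i<3. bit_sign (z i)) - (\<Prod>i<3. bit_sign (z i))) / 2"
proof -
  have "card {i. i < 3 \<and> z i = 1} = (\<Sum>i<3. of_bool (z i = 1))"
    by (simp add: Int_def)
  also have "\<dots> = of_bool (z 0 = 1) + of_bool (z 1 = 1) + of_bool (z 2 = 1)"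
    by (simp add: numeral_3_eq_3 numeral_2_eq_2 del: sum_of_bool_eq)
  finally have hamming_weight:
    "card {i. i < 3 \<and> z i = 1} = of_bool (z 0 = 1) + of_bool (z 1 = 1) + of_bool (z 2 = 1)" .
  show ?thesis
    unfolding Maj3_def hamming_weight
    by (cases "z 0"; cases "z 1"; cases "z 2")
      (simp_all add: bit_sign_def numeral_3_eq_3 numeral_2_eq_2)
qed

lemma bool_comp_Maj3:
  assumes "\<And>x. g x = 1 \<or> g x = - 1"
  shows "bool_comp 3 m Maj3 g x = ((\<Sum>i<3. g (block m i x)) - (\<Prod>i<3. g (block m i x))) / 2"
proof -
  have "bit_sign (sign_bit (g y)) = g y" for y
    using assms [of y] by (auto simp: bit_sign_def sign_bit_def)
  then show ?thesis by (simp add: bool_comp_def Maj3_fourier_expansion)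
qed

lemma fourier_coeff_bool_comp_Maj3:
  assumes "\<And>x. g x = 1 \<or> g x = - 1"
  shows "2 * fourier_coeff (3 * m) (bool_comp 3 m Maj3 g) S
    = (\<Sum>i<3. of_bool (supported_on_block 3 m i S) * fourier_coeff m g (block m i S))
      - (\<Prod>i<3. fourier_coeff m g (block m i S))"
proof -
  have "2 * fourier_coeff (3 * m) (bool_comp 3 m Maj3 g) S
      = (\<Sum>i<3. fourier_coeff (3 * m) (\<lambda>x. g (block m i x)) S)
        - fourier_coeff (3 * m) (\<lambda>x. \<Prod>i<3. g (block m i x)) S"
    by (simp add: fourier_coeff_def bool_comp_Maj3 [OF assms] sum_distrib_right left_diff_distrib
        sum_subtractf sum_divide_distrib [symmetric] diff_divide_distrib sum.swap [of _ "{..<3}"])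
  then show ?thesis
    by (simp add: fourier_coeff_block fourier_coeff_prod_block [where h = "\<lambda>_. g"])
qed

lemma fourier_coeff_bool_comp_Maj3_squared:
  assumes g: "\<And>x. g x = 1 \<or> g x = - 1" and balanced: "fourier_coeff m g 0 = 0"
  shows "(fourier_coeff (3 * m) (bool_comp 3 m Maj3 g) S)\<^sup>2
    = block_mixture 3 m (\<lambda>T. (fourier_coeff m g T)\<^sup>2) S"
proof -
  define coeff where "coeff i = fourier_coeff m g (block m i S)" for i
  define single where "single i = of_bool (supported_on_block 3 m i S) * coeff i" for i
  have coeff_eq_0: "coeff i = 0" if "block m i S = 0" for i
    using that balanced by (simp add: coeff_def)
  have lessThan_3: "{..<3::nat} = {0, 1, 2}" by auto
  have square: "(single i)\<^sup>2 = of_bool (supported_on_block 3 m i S) * (coeff i)\<^sup>2" for i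
    by (simp add: single_def of_bool_def)
  have orthogonal: "single 0 * single 1 = 0" "single 0 * single 2 = 0" "single 1 * single 2 = 0"
    "single 0 * (\<Prod>i<3. coeff i) = 0" "single 1 * (\<Prod>i<3. coeff i) = 0"
    "single 2 * (\<Prod>i<3. coeff i) = 0"
    by (auto simp: single_def supported_on_block_def lessThan_3 coeff_eq_0)
  have "4 * (fourier_coeff (3 * m) (bool_comp 3 m Maj3 g) S)\<^sup>2
      = (2 * fourier_coeff (3 * m) (bool_comp 3 m Maj3 g) S)\<^sup>2"
    by (simp add: power_mult_distrib)
  also have "\<dots> = ((\<Sum>i<3. single i) - (\<Prod>i<3. coeff i))\<^sup>2"
    by (simp add: fourier_coeff_bool_comp_Maj3 [OF g] single_def coeff_def)
  also have "\<dots> = (\<Sum>i<3. (single i)\<^sup>2) + (\<Prod>i<3. coeff i)\<^sup>2"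
    using orthogonal by (auto simp: lessThan_3 power2_eq_square algebra_simps)
  also have "\<dots> = 4 * block_mixture 3 m (\<lambda>T. (fourier_coeff m g T)\<^sup>2) S"
    by (simp add: block_mixture_def square coeff_def prod_power_distrib)
  finally show ?thesis by simp
qed

lemma Maj3_iter_Suc: "Maj3_iter (Suc k) = bool_comp 3 (3 ^ k) Maj3 (Maj3_iter k)"
proof (cases k)
  case 0
  have "bit_sign (sign_bit (bit_sign b)) = bit_sign b" for b
    by (simp add: bit_sign_def sign_bit_def)
  then show ?thesis
    using 0 by (simp add: fun_eq_iff bool_comp_def block_def Maj3_fourier_expansion)
qed simp

lemma Maj3_iter_sign: "Maj3_iter k x = 1 \<or> Maj3_iter k x = - 1"
  by (cases k)
    (simp_all add: Maj3_iter_Suc bool_comp_def Maj3_def bit_sign_def del: Maj3_iter.simps(2,3))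

theorem spread_distribution_Maj3_iter:
  "spread_distribution (3 ^ k) (\<lambda>S. (fourier_coeff (3 ^ k) (Maj3_iter k) S)\<^sup>2) (1 / 3 ^ k)"
proof (induction k)
  case 0
  define e :: "nat \<Rightarrow> bit" where "e = (\<lambda>i. of_bool (i = 0))"
  have e: "e \<in> F2vec 1" "e \<noteq> 0" by (auto simp: e_def F2vec_def fun_eq_iff)
  have "Maj3_iter 0 = character 1 e" by (simp add: character_def e_def fun_eq_iff)
  then have coeff: "fourier_coeff 1 (Maj3_iter 0) S = of_bool (S = e)" if "S \<in> F2vec 1" for S
    using that e(1) by (simp only: fourier_coeff_character)
  have "spread_distribution 1 (\<lambda>S. (fourier_coeff 1 (Maj3_iter 0) S)\<^sup>2) 1"
  proof (rule spread_distribution_1)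
    show "(\<Sum>S\<in>F2vec 1. (fourier_coeff 1 (Maj3_iter 0) S)\<^sup>2) = 1"
      using e(1) by (simp only: coeff cong: sum.cong) (simp add: power2_eq_square)
  qed (use e(2) coeff in auto)
  then show ?case by (simp only: power_0 div_by_1)
next
  case (Suc k)
  then interpret spread_distribution
    "3 ^ k" "\<lambda>S. (fourier_coeff (3 ^ k) (Maj3_iter k) S)\<^sup>2" "1 / 3 ^ k" .
  have "fourier_coeff (3 ^ k) (Maj3_iter k) 0 = 0" using weight_0 by simp
  then have "(\<lambda>S. (fourier_coeff (3 * 3 ^ k) (Maj3_iter (Suc k)) S)\<^sup>2)
      = block_mixture 3 (3 ^ k) (\<lambda>S. (fourier_coeff (3 ^ k) (Maj3_iter k) S)\<^sup>2)"
    unfolding Maj3_iter_Suc using Maj3_iter_sign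
    by (intro ext fourier_coeff_bool_comp_Maj3_squared)
  then show ?case
    using spread_distribution_block_mixture [of 3] by (simp add: mult.commute)
qed

theorem theorem4p2:
  fixes k n d :: nat and f :: "(nat \<Rightarrow> bit) \<Rightarrow> real" and A :: "(nat \<Rightarrow> bit) set"
  assumes "k \<ge> 1" and "n = 3 ^ k" and "f = Maj3_iter k"
    and "d \<le> n"
    and "A \<subseteq> F2vec n" and "F2.subspace A" and "F2.dim A = d"
  shows "(\<Sum>S\<in>A. (fourier_coeff n f S)\<^sup>2) \<le> 4 * real d / real n"
proof -
  have "(\<Sum>S\<in>A. (fourier_coeff n f S)\<^sup>2) \<le> real d / real n"
    using spread_distribution.sum_subspace_le [OF spread_distribution_Maj3_iter, of A k] assms
    by simp
  also have "\<dots> \<le> 4 * real d / real n" by (intro divide_right_mono) auto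
  finally show ?thesis .
qed

end
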